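(* Let $\mathbf C$ be a category with a functor $|\cdot|:\mathbf C\to\mathbf{Set}$, assume $\mathbf C$ has binary products, let $F:\mathbf C\to\mathbf C$ be a functor and let $\lambda:\Psi\to\Psi F$ be an indexed morphism such that $\lambda_X(\equiv_X)=\,\equiv_{FX}$ for every object $X$. Then for every $F$-coalgebra homomorphism $f:(X,\alpha)\to(Y,\beta)$ (i.e. $f:X\to Y$ with $Ff\circ\alpha=\beta\circ f$) we have $$f^*(\equiv_Y)\subseteq \alpha^*\big(\lambda_X(f^*(\equiv_Y))\big),$$ i.e. the behavioural equivalence induced by $f$ is an $\alpha^*\circ\lambda_X$-coalgebra in the poset $\Psi X$.
   Context: Binary products in $\mathbf C$ are written $X\otimes Y$, with projections $\pi_1^X,\pi_2^X:X\otimes X\to X$; for $g:X\to Y$, $g\otimes g:X\otimes X\to Y\otimes Y$ is the induced morphism. $\Psi X$ is the poset (under $\subseteq$) of subsets of $|X\otimes X|$, and for $g:X\to Y$ the reindexing is $g^*:\Psi Y\to\Psi X$, $g^*(S)=|g\otimes g|^{-1}(S)$. Abstract equality: $\equiv_X=\langle|\pi_1^X|,|\pi_2^X|\rangle^{-1}(\{(x,x)\mid x\in|X|\})\in\Psi X$. An indexed morphism $\lambda:\Psi\to\Psi F$ is a family of monotone maps $\lambda_X:\Psi X\to\Psi(FX)$ such that $\lambda_X(g^*S)=(Fg)^*(\lambda_Y S)$ for all $g:X\to Y$ and $S\in\Psi Y$. For a coalgebra $\alpha:X\to FX$, $\alpha^*:\Psi(FX)\to\Psi X$ is reindexing along $\alpha$.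 *)

theory Defs
  imports Main "HOL-Library.FuncSet"
begin

section \<open>Categories and functors\<close>

record ('o, 'm) cat =
  Obj :: "'o set"
  Arr :: "'m set"
  Dom :: "'m \<Rightarrow> 'o"
  Cod :: "'m \<Rightarrow> 'o"
  Id :: "'o \<Rightarrow> 'm"
  Comp :: "'m \<Rightarrow> 'm \<Rightarrow> 'm"

text \<open>\<^term>\<open>Comp C g f\<close> is \<open>g\<close> after \<open>f\<close>.\<close>

definition Hom :: "('o, 'm) cat \<Rightarrow> 'o \<Rightarrow> 'o \<Rightarrow> 'm set" where
  "Hom C X Y = {f \<in> Arr C. Dom C f = X \<and> Cod C f = Y}"

definition category :: "('o, 'm) cat \<Rightarrow> bool" where
  "category C \<longleftrightarrow>
     (\<forall>f\<in>Arr C. Dom C f \<in> Obj C \<and> Cod C f \<in> Obj C) \<and>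
     (\<forall>X\<in>Obj C. Id C X \<in> Hom C X X) \<and>
     (\<forall>X\<in>Obj C. \<forall>Y\<in>Obj C. \<forall>Z\<in>Obj C. \<forall>f\<in>Hom C X Y. \<forall>g\<in>Hom C Y Z.
        Comp C g f \<in> Hom C X Z) \<and>
     (\<forall>X\<in>Obj C. \<forall>Y\<in>Obj C. \<forall>f\<in>Hom C X Y.
        Comp C f (Id C X) = f \<and> Comp C (Id C Y) f = f) \<and>
     (\<forall>W\<in>Obj C. \<forall>X\<in>Obj C. \<forall>Y\<in>Obj C. \<forall>Z\<in>Obj C.
        \<forall>f\<in>Hom C W X. \<forall>g\<in>Hom C X Y. \<forall>h\<in>Hom C Y Z.
          Comp C h (Comp C g f) = Comp C (Comp C h g) f)"

record ('o, 'm, 'p, 'n) func =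
  FObj :: "'o \<Rightarrow> 'p"
  FArr :: "'m \<Rightarrow> 'n"

definition is_functor ::
  "('o, 'm) cat \<Rightarrow> ('p, 'n) cat \<Rightarrow> ('o, 'm, 'p, 'n) func \<Rightarrow> bool" where
  "is_functor C D F \<longleftrightarrow>
     (\<forall>X\<in>Obj C. FObj F X \<in> Obj D) \<and>
     (\<forall>X\<in>Obj C. \<forall>Y\<in>Obj C. \<forall>f\<in>Hom C X Y. FArr F f \<in> Hom D (FObj F X) (FObj F Y)) \<and>
     (\<forall>X\<in>Obj C. FArr F (Id C X) = Id D (FObj F X)) \<and>
     (\<forall>X\<in>Obj C. \<forall>Y\<in>Obj C. \<forall>Z\<in>Obj C. \<forall>f\<in>Hom C X Y. \<forall>g\<in>Hom C Y Z.
        FArr F (Comp C g f) = Comp D (FArr F g) (FArr F f))"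

section \<open>The category of sets\<close>

text \<open>
  The objects are the subsets of the type \<^typ>\<open>'u\<close>, which plays the role of the universe
  of sets. An arrow carries its domain and codomain; its function is required to be
  \<^const>\<open>undefined\<close> outside the domain, so that equality of arrows is equality of
  functions between sets.
\<close>

type_synonym 'u set_arr = "'u set \<times> ('u \<Rightarrow> 'u) \<times> 'u set"

definition set_cat :: "('u set, 'u set_arr) cat" where
  "set_cat =
     \<lparr>Obj = UNIV,
      Arr = {(A, h, B). h \<in> A \<rightarrow>\<^sub>E B},
      Dom = (\<lambda>(A, h, B). A),
      Cod = (\<lambda>(A, h, B). B),
      Id = (\<lambda>A. (A, restrict id A, A)),
      Comp = (\<lambda>(B', k, C) (A, h, B). (A, compose A k h, C))\<rparr>"

definition apply_arr :: "'u set_arr \<Rightarrow> 'u \<Rightarrow> 'u" where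
  "apply_arr h = fst (snd h)"

lemma category_set_cat: "category set_cat"
  unfolding category_def set_cat_def Hom_def
  by (auto simp: compose_def fun_eq_iff PiE_iff extensional_def)

section \<open>Binary products\<close>

record ('o, 'm) binprod =
  Prod :: "'o \<Rightarrow> 'o \<Rightarrow> 'o"
  Pr1 :: "'o \<Rightarrow> 'o \<Rightarrow> 'm"
  Pr2 :: "'o \<Rightarrow> 'o \<Rightarrow> 'm"

definition binary_products :: "('o, 'm) cat \<Rightarrow> ('o, 'm) binprod \<Rightarrow> bool" where
  "binary_products C P \<longleftrightarrow>
     (\<forall>X\<in>Obj C. \<forall>Y\<in>Obj C.
        Prod P X Y \<in> Obj C \<and>
        Pr1 P X Y \<in> Hom C (Prod P X Y) X \<and>
        Pr2 P X Y \<in> Hom C (Prod P X Y) Y \<and>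
        (\<forall>Z\<in>Obj C. \<forall>f\<in>Hom C Z X. \<forall>g\<in>Hom C Z Y.
           \<exists>!h. h \<in> Hom C Z (Prod P X Y) \<and>
                Comp C (Pr1 P X Y) h = f \<and> Comp C (Pr2 P X Y) h = g))"

definition pairing :: "('o, 'm) cat \<Rightarrow> ('o, 'm) binprod \<Rightarrow> 'm \<Rightarrow> 'm \<Rightarrow> 'm" where
  "pairing C P f g =
     (THE h. h \<in> Hom C (Dom C f) (Prod P (Cod C f) (Cod C g)) \<and>
             Comp C (Pr1 P (Cod C f) (Cod C g)) h = f \<and>
             Comp C (Pr2 P (Cod C f) (Cod C g)) h = g)"

definition tensor :: "('o, 'm) cat \<Rightarrow> ('o, 'm) binprod \<Rightarrow> 'm \<Rightarrow> 'm \<Rightarrow> 'm" where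
  "tensor C P f g =
     pairing C P (Comp C f (Pr1 P (Dom C f) (Dom C g)))
                 (Comp C g (Pr2 P (Dom C f) (Dom C g)))"

section \<open>Abstract relations\<close>

definition Psi ::
  "('o, 'm) binprod \<Rightarrow> ('o, 'm, 'u set, 'u set_arr) func \<Rightarrow> 'o \<Rightarrow> 'u set set" where
  "Psi P U X = Pow (FObj U (Prod P X X))"

definition reindex ::
  "('o, 'm) cat \<Rightarrow> ('o, 'm) binprod \<Rightarrow> ('o, 'm, 'u set, 'u set_arr) func \<Rightarrow>
   'm \<Rightarrow> 'u set \<Rightarrow> 'u set" where
  "reindex C P U g S =
     {w \<in> FObj U (Prod P (Dom C g) (Dom C g)). apply_arr (FArr U (tensor C P g g)) w \<in> S}"

definition abs_eq ::
  "('o, 'm) binprod \<Rightarrow> ('o, 'm, 'u set, 'u set_arr) func \<Rightarrow> 'o \<Rightarrow> 'u set" where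
  "abs_eq P U X =
     {w \<in> FObj U (Prod P X X).
        (apply_arr (FArr U (Pr1 P X X)) w, apply_arr (FArr U (Pr2 P X X)) w)
          \<in> {(x, x) | x. x \<in> FObj U X}}"

definition indexed_morphism ::
  "('o, 'm) cat \<Rightarrow> ('o, 'm) binprod \<Rightarrow> ('o, 'm, 'u set, 'u set_arr) func \<Rightarrow>
   ('o, 'm, 'o, 'm) func \<Rightarrow> ('o \<Rightarrow> 'u set \<Rightarrow> 'u set) \<Rightarrow> bool" where
  "indexed_morphism C P U F l \<longleftrightarrow>
     (\<forall>X\<in>Obj C. l X \<in> Psi P U X \<rightarrow> Psi P U (FObj F X) \<and> mono_on (Psi P U X) (l X)) \<and>
     (\<forall>X\<in>Obj C. \<forall>Y\<in>Obj C. \<forall>g\<in>Hom C X Y. \<forall>S\<in>Psi P U Y.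
        l X (reindex C P U g S) = reindex C P U (FArr F g) (l Y S))"

section \<open>Coalgebras\<close>

definition coalgebra ::
  "('o, 'm) cat \<Rightarrow> ('o, 'm, 'o, 'm) func \<Rightarrow> 'o \<Rightarrow> 'm \<Rightarrow> bool" where
  "coalgebra C F X a \<longleftrightarrow> X \<in> Obj C \<and> a \<in> Hom C X (FObj F X)"

definition coalgebra_hom ::
  "('o, 'm) cat \<Rightarrow> ('o, 'm, 'o, 'm) func \<Rightarrow> 'm \<Rightarrow> 'o \<Rightarrow> 'm \<Rightarrow> 'o \<Rightarrow> 'm \<Rightarrow> bool" where
  "coalgebra_hom C F f X a Y b \<longleftrightarrow>
     coalgebra C F X a \<and> coalgebra C F Y b \<and> f \<in> Hom C X Y \<and>
     Comp C (FArr F f) a = Comp C b f"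

text \<open>
  A poset is a category with at most one arrow between any two objects. An endofunctor on
  it is a monotone self-map \<open>h\<close>, and an \<open>h\<close>-coalgebra is an element \<open>x\<close> with \<open>x \<le> h x\<close>.
\<close>

definition poset_coalgebra :: "'a::order set \<Rightarrow> ('a \<Rightarrow> 'a) \<Rightarrow> 'a \<Rightarrow> bool" where
  "poset_coalgebra A h x \<longleftrightarrow> h \<in> A \<rightarrow> A \<and> mono_on A h \<and> x \<in> A \<and> x \<le> h x"

end

theory Submission imports Defs begin

text \<open>
  For every \<open>g : X \<rightarrow> Y\<close> the relation \<open>g\<^sup>*(\<equiv>\<^sub>Y)\<close> is the kernel of \<open>|g|\<close>: it contains exactly those
  \<open>w \<in> |X \<otimes> X|\<close> whose two projections are identified by \<open>|g|\<close>. Since \<open>\<lambda>\<close> commutes with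
  reindexing and preserves abstract equality, \<open>\<lambda>\<^sub>X(f\<^sup>*(\<equiv>\<^sub>Y)) = (Ff)\<^sup>*(\<equiv>\<^sub>F\<^sub>Y)\<close> is the kernel of \<open>|Ff|\<close>.
  So \<open>\<alpha>\<^sup>*(\<lambda>\<^sub>X(f\<^sup>*(\<equiv>\<^sub>Y)))\<close> is the kernel of \<open>|Ff \<circ> \<alpha>| = |\<beta> \<circ> f|\<close>, which contains that of \<open>|f|\<close>.
\<close>

lemma comp_in_Hom:
  assumes "category C" and "f \<in> Hom C X Y" and "g \<in> Hom C Y Z"
  shows "Comp C g f \<in> Hom C X Z"
proof -
  have "X \<in> Obj C" "Y \<in> Obj C" "Z \<in> Obj C"
    using assms unfolding category_def Hom_def by auto
  then show ?thesis
    using assms unfolding category_def by blast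
qed

lemma Hom_objects:
  assumes "category C" and "f \<in> Hom C X Y"
  shows "X \<in> Obj C" and "Y \<in> Obj C"
  using assms unfolding category_def Hom_def by auto

lemma apply_arr_mem:
  assumes "category C" and "is_functor C set_cat U" and "f \<in> Hom C X Y"
    and "w \<in> FObj U X"
  shows "apply_arr (FArr U f) w \<in> FObj U Y"
proof -
  have "FArr U f \<in> Hom set_cat (FObj U X) (FObj U Y)"
    using assms(2,3) Hom_objects[OF assms(1,3)] unfolding is_functor_def by blast
  then show ?thesis
    using assms(4) by (auto simp: Hom_def set_cat_def apply_arr_def)
qed

text \<open>Composition in \<open>set_cat\<close> is \<open>compose\<close>, which is
  \<open>undefined\<close> off the domain; hence the restriction to elements of
  \<open>FObj U X\<close>, the domain carried by \<open>FArr U f\<close>.\<close>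

lemma apply_arr_comp:
  assumes "category C" and "is_functor C set_cat U"
    and "f \<in> Hom C X Y" and "g \<in> Hom C Y Z" and "w \<in> FObj U X"
  shows "apply_arr (FArr U (Comp C g f)) w = apply_arr (FArr U g) (apply_arr (FArr U f) w)"
proof -
  note objs = Hom_objects[OF assms(1,3)] Hom_objects[OF assms(1,4)]
  have "FArr U f \<in> Hom set_cat (FObj U X) (FObj U Y)"
    using assms(2,3) objs unfolding is_functor_def by blast
  moreover have "FArr U (Comp C g f) = Comp set_cat (FArr U g) (FArr U f)"
    using assms(2,3,4) objs unfolding is_functor_def by blast
  ultimately show ?thesis
    using assms(5)
    by (auto simp: Hom_def set_cat_def apply_arr_def compose_def split: prod.splits)
qed

text \<open>The universal property of \<open>Prod P Y Y\<close> makes the definite description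
  behind \<open>pairing\<close> well defined for the two composites of \<open>g\<close> with the
  projections.\<close>

lemma tensor_self:
  assumes "category C" and "binary_products C P" and "g \<in> Hom C X Y"
  shows "tensor C P g g \<in> Hom C (Prod P X X) (Prod P Y Y)"
    and "Comp C (Pr1 P Y Y) (tensor C P g g) = Comp C g (Pr1 P X X)"
    and "Comp C (Pr2 P Y Y) (tensor C P g g) = Comp C g (Pr2 P X X)"
proof -
  note objs = Hom_objects[OF assms(1,3)]
  let ?u = "Comp C g (Pr1 P X X)" and ?v = "Comp C g (Pr2 P X X)"
  let ?p = "\<lambda>h. h \<in> Hom C (Prod P X X) (Prod P Y Y) \<and>
    Comp C (Pr1 P Y Y) h = ?u \<and> Comp C (Pr2 P Y Y) h = ?v"
  have pr: "Prod P X X \<in> Obj C" "Pr1 P X X \<in> Hom C (Prod P X X) X"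
      "Pr2 P X X \<in> Hom C (Prod P X X) X"
    using assms(2) objs unfolding binary_products_def by blast+
  have uv: "?u \<in> Hom C (Prod P X X) Y" "?v \<in> Hom C (Prod P X X) Y"
    using comp_in_Hom[OF assms(1) _ assms(3)] pr by auto
  have "\<exists>!h. ?p h"
    using assms(2) objs pr(1) uv unfolding binary_products_def by blast
  then have "?p (THE h. ?p h)"
    by (rule theI')
  \<comment> \<open>The domains and codomains that \<open>pairing\<close> reads off its arguments
    are those of \<open>?u\<close> and \<open>?v\<close>, namely \<open>Prod P X X\<close> and
    \<open>Y\<close>.\<close>
  moreover have "tensor C P g g = (THE h. ?p h)"
    using assms(3) uv by (simp add: tensor_def pairing_def Hom_def)
  ultimately show "tensor C P g g \<in> Hom C (Prod P X X) (Prod P Y Y)"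
    and "Comp C (Pr1 P Y Y) (tensor C P g g) = ?u"
    and "Comp C (Pr2 P Y Y) (tensor C P g g) = ?v"
    by simp_all
qed

text \<open>This is the image under \<open>U\<close> of the two equations defining the tensor. It
  gives coordinatewise control of its action even if \<open>U\<close> does not send products to
  cartesian products.\<close>

lemma projections_apply_tensor:
  assumes "category C" and "is_functor C set_cat U" and "binary_products C P"
    and "g \<in> Hom C X Y" and "w \<in> FObj U (Prod P X X)"
  shows "apply_arr (FArr U (Pr1 P Y Y)) (apply_arr (FArr U (tensor C P g g)) w)
           = apply_arr (FArr U g) (apply_arr (FArr U (Pr1 P X X)) w)"
    and "apply_arr (FArr U (Pr2 P Y Y)) (apply_arr (FArr U (tensor C P g g)) w)
           = apply_arr (FArr U g) (apply_arr (FArr U (Pr2 P X X)) w)"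
proof -
  note t = tensor_self[OF assms(1,3,4)] and objs = Hom_objects[OF assms(1,4)]
  have pr: "Pr1 P X X \<in> Hom C (Prod P X X) X" "Pr2 P X X \<in> Hom C (Prod P X X) X"
      "Pr1 P Y Y \<in> Hom C (Prod P Y Y) Y" "Pr2 P Y Y \<in> Hom C (Prod P Y Y) Y"
    using assms(3) objs unfolding binary_products_def by blast+
  note comp = apply_arr_comp[OF assms(1,2) _ _ assms(5)]
  show "apply_arr (FArr U (Pr1 P Y Y)) (apply_arr (FArr U (tensor C P g g)) w)
      = apply_arr (FArr U g) (apply_arr (FArr U (Pr1 P X X)) w)"
    using comp[OF t(1) pr(3)] comp[OF pr(1) assms(4)] t(2) by simp
  show "apply_arr (FArr U (Pr2 P Y Y)) (apply_arr (FArr U (tensor C P g g)) w)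
      = apply_arr (FArr U g) (apply_arr (FArr U (Pr2 P X X)) w)"
    using comp[OF t(1) pr(4)] comp[OF pr(2) assms(4)] t(3) by simp
qed

lemma reindex_abs_eq:
  assumes "category C" and "is_functor C set_cat U" and "binary_products C P"
    and "g \<in> Hom C X Y"
  shows "reindex C P U g (abs_eq P U Y) =
    {w \<in> FObj U (Prod P X X).
       apply_arr (FArr U g) (apply_arr (FArr U (Pr1 P X X)) w)
         = apply_arr (FArr U g) (apply_arr (FArr U (Pr2 P X X)) w)}"
proof -
  \<comment> \<open>Membership in \<open>abs_eq\<close> asks for a common value lying in
    \<open>FObj U Y\<close>, so one of the two values has to be located there.\<close>
  have "Pr2 P X X \<in> Hom C (Prod P X X) X"
    using assms(3) Hom_objects[OF assms(1,4)] unfolding binary_products_def by blast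
  then have "apply_arr (FArr U g) (apply_arr (FArr U (Pr2 P X X)) w) \<in> FObj U Y"
    if "w \<in> FObj U (Prod P X X)" for w
    using apply_arr_mem[OF assms(1,2)] assms(4) that by blast
  moreover have "apply_arr (FArr U (tensor C P g g)) w \<in> FObj U (Prod P Y Y)"
    if "w \<in> FObj U (Prod P X X)" for w
    using apply_arr_mem[OF assms(1,2) tensor_self(1)[OF assms(1,3,4)] that] .
  moreover have "Dom C g = X"
    using assms(4) by (simp add: Hom_def)
  ultimately show ?thesis
    using projections_apply_tensor[OF assms]
    unfolding reindex_def abs_eq_def by auto
qed

lemma reindex_in_Psi:
  assumes "g \<in> Hom C X Y"
  shows "reindex C P U g S \<in> Psi P U X"
  using assms by (auto simp: reindex_def Psi_def Hom_def)

lemma reindex_mono: "S \<subseteq> T \<Longrightarrow> reindex C P U g S \<subseteq> reindex C P U g T"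
  by (auto simp: reindex_def)

theorem theorem1:
  fixes C :: "('o, 'm) cat"
    and U :: "('o, 'm, 'u set, 'u set_arr) func"
    and P :: "('o, 'm) binprod"
    and F :: "('o, 'm, 'o, 'm) func"
    and l :: "'o \<Rightarrow> 'u set \<Rightarrow> 'u set"
    and X Y :: 'o
    and \<alpha> \<beta> f :: 'm
  assumes "category C"
    and "is_functor C set_cat U"
    and "binary_products C P"
    and "is_functor C C F"
    and "indexed_morphism C P U F l"
    and "\<forall>Z\<in>Obj C. l Z (abs_eq P U Z) = abs_eq P U (FObj F Z)"
    and "coalgebra_hom C F f X \<alpha> Y \<beta>"
  shows "reindex C P U f (abs_eq P U Y)
           \<subseteq> reindex C P U \<alpha> (l X (reindex C P U f (abs_eq P U Y)))
       \<and> poset_coalgebra (Psi P U X) (reindex C P U \<alpha> \<circ> l X)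
           (reindex C P U f (abs_eq P U Y))"
proof -
  have X: "X \<in> Obj C" and Y: "Y \<in> Obj C" and f: "f \<in> Hom C X Y"
    and \<alpha>: "\<alpha> \<in> Hom C X (FObj F X)" and \<beta>: "\<beta> \<in> Hom C Y (FObj F Y)"
    and hom: "Comp C (FArr F f) \<alpha> = Comp C \<beta> f"
    using assms(7) unfolding coalgebra_hom_def coalgebra_def by auto
  have Ff: "FArr F f \<in> Hom C (FObj F X) (FObj F Y)"
    using assms(4) X Y f unfolding is_functor_def by blast
  have pr: "Pr1 P X X \<in> Hom C (Prod P X X) X" "Pr2 P X X \<in> Hom C (Prod P X X) X"
    using assms(3) X unfolding binary_products_def by blast+
  let ?R = "reindex C P U f (abs_eq P U Y)"
  have "abs_eq P U Y \<in> Psi P U Y"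
    by (auto simp: abs_eq_def Psi_def)
  \<comment> \<open>Naturality of \<open>l\<close> at \<open>f\<close>, followed by preservation of
    abstract equality at \<open>Y\<close>.\<close>
  then have lR: "l X ?R = reindex C P U (FArr F f) (abs_eq P U (FObj F Y))"
    using assms(5,6) X Y f unfolding indexed_morphism_def by metis
  \<comment> \<open>The homomorphism square, evaluated at an element through
    \<open>U\<close>.\<close>
  have swap: "apply_arr (FArr U (FArr F f)) (apply_arr (FArr U \<alpha>) x)
      = apply_arr (FArr U \<beta>) (apply_arr (FArr U f) x)" if "x \<in> FObj U X" for x
    using apply_arr_comp[OF assms(1,2) \<alpha> Ff that] apply_arr_comp[OF assms(1,2) f \<beta> that] hom
    by simp
  have sub: "?R \<subseteq> reindex C P U \<alpha> (l X ?R)"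
  proof
    fix w
    assume "w \<in> ?R"
    then have w: "w \<in> FObj U (Prod P X X)"
      and eq: "apply_arr (FArr U f) (apply_arr (FArr U (Pr1 P X X)) w)
        = apply_arr (FArr U f) (apply_arr (FArr U (Pr2 P X X)) w)"
      unfolding reindex_abs_eq[OF assms(1-3) f] by auto
    \<comment> \<open>The projections of this element are the images under \<alpha> of those of
      \<open>w\<close>. By \<open>swap\<close>, applying \<open>FArr F f\<close> to them amounts to
      applying \<beta> to the two sides of \<open>eq\<close>.\<close>
    have "apply_arr (FArr U (tensor C P \<alpha> \<alpha>)) w \<in> l X ?R"
      unfolding lR reindex_abs_eq[OF assms(1-3) Ff]
      using apply_arr_mem[OF assms(1,2) tensor_self(1)[OF assms(1,3) \<alpha>] w]
        projections_apply_tensor[OF assms(1-3) \<alpha> w] eq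
        swap[OF apply_arr_mem[OF assms(1,2) pr(1) w]]
        swap[OF apply_arr_mem[OF assms(1,2) pr(2) w]]
      by simp
    then show "w \<in> reindex C P U \<alpha> (l X ?R)"
      using w \<alpha> by (simp add: reindex_def Hom_def)
  qed
  have "mono_on (Psi P U X) (l X)"
    using assms(5) X unfolding indexed_morphism_def by blast
  then have "mono_on (Psi P U X) (reindex C P U \<alpha> \<circ> l X)"
    unfolding mono_on_def comp_def by (meson reindex_mono)
  \<comment> \<open>Reindexing along \<alpha> cuts out a subset of
    \<open>FObj U (Prod P X X)\<close> from any set.\<close>
  moreover have "reindex C P U \<alpha> \<circ> l X \<in> Psi P U X \<rightarrow> Psi P U X"
    by (simp add: Pi_I reindex_in_Psi[OF \<alpha>])
  ultimately show ?thesis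
    using sub reindex_in_Psi[OF f, of P U "abs_eq P U Y"]
    by (simp add: poset_coalgebra_def)
qed

end
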